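(* Suppose $\mathcal Y=\mathbb R^k$ and $\mathbb P_{\hat\theta}$ admits a density. Among all $\mathbb P_0$ such that $\frac{d\mathbb P_{\hat\theta}}{d\mathbb P_0}$ exists and is continuous and positive almost surely, an optimal choice of $\mathbb P_0$ that minimizes $$M(\mathbb P_0,\{\mathbb Q: d_\phi(\mathbb P_{\hat\theta},\mathbb Q)\le\lambda\},\delta)$$ is the center of the $\phi$-divergence ball, $\mathbb P_{\hat\theta}$. Moreover, this choice gives $$M(\mathbb P_0,\{\mathbb Q: d_\phi(\mathbb P_{\hat\theta},\mathbb Q)\le\lambda\},\delta)={\epsilon'}^{-1}(\delta,\lambda,\phi),$$ where ${\epsilon'}^{-1}(\cdot,\lambda,\phi)$ is the inverse, with respect to $\epsilon$, of the function $\epsilon'(\epsilon,\lambda,\phi)$, given by $${\epsilon'}^{-1}(x,\lambda,\phi)=\min\{\epsilon\ge0:\ \epsilon'(\epsilon,\lambda,\phi)\ge x\}.$$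
   Context: $\mathbb P_{\hat\theta}$ is a probability measure on $\mathcal Y$ (the baseline distribution), with density $p_{\hat\theta}$; $\lambda>0$ is a ball radius and $\delta>0$. The function $\phi:\mathbb R_+\to\mathbb R_+$ is convex with $\phi(1)=0$, twice continuously differentiable with $\phi''(1)\ne0$, and is extended by $\phi(x)=+\infty$ for $x<0$. For $\mathbb P_2$ absolutely continuous with respect to $\mathbb P_1$, $$d_\phi(\mathbb P_1,\mathbb P_2)=\int_{\mathcal Y}\phi\Big(\frac{d\mathbb P_2}{d\mathbb P_1}\Big)\,d\mathbb P_1 .$$ $M(\mathbb P_0,\{\mathbb Q: d_\phi(\mathbb P_{\hat\theta},\mathbb Q)\le\lambda\},\delta)$ is the optimal value of the problem of maximizing $\mathbb Q(A)$ over pairs $(\mathbb Q,A)$, where $\mathbb Q$ ranges over all distributions absolutely continuous with respect to $\mathbb P_{\hat\theta}$ with $d_\phi(\mathbb P_{\hat\theta},\mathbb Q)\le\lambda$ and $A\subset\mathcal Y$ ranges over events with $\mathbb P_0(A)\le\delta$. The function $\epsilon'$ is the adjusted tolerance level in the equivalence $\max_{d_\phi(\mathbb P_{\hat\theta},\mathbb Q)\le\lambda}\mathbb Q(A)\le\epsilon\iff\mathbb P_{\hat\theta}(A)\le\epsilon'$ for an event $A$, and is defined by $$\epsilon'(\epsilon,\lambda,\phi)=\max\left\{1-\inf_{\substack{z>0,\ z_0+\pi z\le\ell_\phi\\ \underline m(\phi^* )\le z_0+z\le\overline m(\phi^* )}}\left\{\frac{\phi^*(z_0+z)-z_0-\epsilon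 z+\lambda}{\phi^*(z_0+z)-\phi^*(z_0)}\right\},\ 0\right\}.$$ Here $\phi^*(t)=\sup_x\{tx-\phi(x)\}$ is the conjugate of $\phi$; $\underline m(\phi^* )=\sup\{m\in\mathbb R:\phi^*\text{ is a finite constant on }(-\infty,m]\}$; $\overline m(\phi^* )=\inf\{m\in\mathbb R:\phi^*(m)=+\infty\}$; $\ell_\phi=\lim_{x\to+\infty}\phi(x)/x$; and, with $Leb$ the Lebesgue measure on $\mathbb R^k$, $\pi=-\infty$ if $Leb\{[p_{\hat\theta}=0]\}=0$, $\pi=0$ if $Leb\{[p_{\hat\theta}=0]\}>0$ and $Leb\{[p_{\hat\theta}=0]\setminus A\}=0$, and $\pi=1$ otherwise, $A$ being the event in the equivalence.
   Formalization: The min defining the inverse is taken as an infimum, proved attained if some level ε≤1 qualifies (for KL and δ>e^{-λ} the set is (1,∞), with no min); pairs with φ*(z0+z)=+∞, where the quotient is ∞/∞, are left out of the infimum defining ε'. *)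

theory Defs
  imports "HOL-Analysis.Analysis" "HOL-Probability.Probability"
begin

text \<open>
  Only the values of the generator on the closed half line are relevant.  Twice continuous
  differentiability is asked for on the open half line, together with continuity at \<open>0\<close>: this
  follows from (one-sided) differentiability at \<open>0\<close>, and it also admits generators such as
  \<open>x ln x - x + 1\<close> (Kullback-Leibler) whose derivative is infinite at \<open>0\<close>.
\<close>

definition divergence_generator :: "(real \<Rightarrow> real) \<Rightarrow> bool" where
  "divergence_generator \<phi> \<longleftrightarrow>
     convex_on {0..} \<phi> \<and> (\<forall>x\<ge>0. 0 \<le> \<phi> x) \<and> \<phi> 1 = 0 \<and> continuous_on {0..} \<phi> \<and>
     (\<exists>\<phi>' \<phi>''. (\<forall>x>0. (\<phi> has_real_derivative \<phi>' x) (at x)) \<and>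
               (\<forall>x>0. (\<phi>' has_real_derivative \<phi>'' x) (at x)) \<and>
               continuous_on {0<..} \<phi>'' \<and> \<phi>'' 1 \<noteq> 0)"

definition extend_phi :: "(real \<Rightarrow> real) \<Rightarrow> real \<Rightarrow> ereal" where
  "extend_phi \<phi> x = (if x < 0 then \<infinity> else ereal (\<phi> x))"

text \<open>Meaningful when \<open>P2\<close> is absolutely continuous with respect to \<open>P1\<close>.\<close>

definition phi_divergence :: "(real \<Rightarrow> real) \<Rightarrow> 'a measure \<Rightarrow> 'a measure \<Rightarrow> ennreal" where
  "phi_divergence \<phi> P1 P2 =
     (\<integral>\<^sup>+ y. e2ennreal (extend_phi \<phi> (enn2real (RN_deriv P1 P2 y))) \<partial>P1)"

definition phi_ball :: "(real \<Rightarrow> real) \<Rightarrow> 'a measure \<Rightarrow> real \<Rightarrow> 'a measure set" where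
  "phi_ball \<phi> P lam =
     {Q. prob_space Q \<and> sets Q = sets P \<and> absolutely_continuous P Q \<and>
         phi_divergence \<phi> P Q \<le> ennreal lam}"

definition worst_case_value :: "'a measure \<Rightarrow> 'a measure set \<Rightarrow> real \<Rightarrow> ereal" where
  "worst_case_value P0 U \<delta> =
     Sup {ereal (measure Q A) | Q A. Q \<in> U \<and> A \<in> sets P0 \<and> measure P0 A \<le> \<delta>}"

text \<open>
  Densities are determined only up to null sets, so the requirement concerns some version \<open>L\<close> of
  the Radon-Nikodym derivative of \<open>P\<close> with respect to \<open>P0\<close>.
\<close>

definition admissible_sampling :: "'a::euclidean_space measure \<Rightarrow> 'a measure \<Rightarrow> bool" where
  "admissible_sampling P P0 \<longleftrightarrow>
     prob_space P0 \<and> sets P0 = sets borel \<and>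
     (\<exists>L\<in>borel_measurable borel. P = density P0 (\<lambda>y. ennreal (L y)) \<and>
        (AE y in P0. isCont L y \<and> (0::real) < L y))"

definition phi_conj :: "(real \<Rightarrow> real) \<Rightarrow> real \<Rightarrow> ereal" where
  "phi_conj \<phi> t = (SUP x. ereal (t * x) - extend_phi \<phi> x)"

definition m_lower :: "(real \<Rightarrow> ereal) \<Rightarrow> ereal" where
  "m_lower f = Sup {ereal m | m. \<exists>c::real. \<forall>t\<le>m. f t = ereal c}"

definition m_upper :: "(real \<Rightarrow> ereal) \<Rightarrow> ereal" where
  "m_upper f = Inf {ereal m | m. f m = \<infinity>}"

definition ell :: "(real \<Rightarrow> real) \<Rightarrow> ereal" where
  "ell \<phi> = Lim at_top (\<lambda>x. extend_phi \<phi> x / ereal x)"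

definition tol_pi :: "('a::euclidean_space \<Rightarrow> real) \<Rightarrow> 'a set \<Rightarrow> ereal" where
  "tol_pi p A =
     (if emeasure lebesgue {y. p y = 0} = 0 then - \<infinity>
      else if emeasure lebesgue ({y. p y = 0} - A) = 0 then 0
      else 1)"

text \<open>
  If the conjugate is infinite at \<open>m_upper\<close> (for instance, for the generator \<open>(sqrt x - 1)^2\<close>), the
  quotient at \<open>z0 + z = m_upper\<close> is the undefined expression \<open>\<infinity>/\<infinity>\<close>, which the library evaluates
  to \<open>0\<close>; such pairs are left out.  (The limit of the quotient there is \<open>1\<close>, which would not affect
  the maximum with \<open>0\<close>.)  A positive numerator over \<open>0\<close> is \<open>\<infinity>\<close> in the extended reals.
\<close>

definition adjusted_tol :: "ereal \<Rightarrow> real \<Rightarrow> real \<Rightarrow> (real \<Rightarrow> real) \<Rightarrow> ereal" where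
  "adjusted_tol \<pi> \<epsilon> lam \<phi> =
     max (1 - Inf {(phi_conj \<phi> (z0 + z) - ereal z0 - ereal (\<epsilon> * z) + ereal lam) /
                     (phi_conj \<phi> (z0 + z) - phi_conj \<phi> z0) | z0 z.
                   0 < z \<and> ereal z0 + \<pi> * ereal z \<le> ell \<phi> \<and>
                   m_lower (phi_conj \<phi>) \<le> ereal (z0 + z) \<and>
                   ereal (z0 + z) \<le> m_upper (phi_conj \<phi>) \<and>
                   phi_conj \<phi> (z0 + z) < \<infinity>})
         0"

definition tol_levels :: "ereal \<Rightarrow> real \<Rightarrow> real \<Rightarrow> (real \<Rightarrow> real) \<Rightarrow> real set" where
  "tol_levels \<pi> x lam \<phi> = {\<epsilon>. 0 \<le> \<epsilon> \<and> ereal x \<le> adjusted_tol \<pi> \<epsilon> lam \<phi>}"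

text \<open>
  The generalized inverse is the infimum of the levels: if \<open>x\<close> exceeds the adjusted tolerance at
  \<open>\<epsilon> = 1\<close>, the levels form the open ray \<open>{1<..}\<close>, which has no minimum.
\<close>

definition adjusted_tol_inv :: "ereal \<Rightarrow> real \<Rightarrow> real \<Rightarrow> (real \<Rightarrow> real) \<Rightarrow> ereal" where
  "adjusted_tol_inv \<pi> x lam \<phi> = Inf (ereal ` tol_levels \<pi> x lam \<phi>)"

end

theory Submission
  imports Defs
begin

text \<open>
  A finite value \<open>\<phi>\<^sup>* (z0 + z)\<close> already forces \<open>z0 + \<pi> z \<le> \<ell>\<close> for each of the three values of
  \<open>\<pi>\<close>, so \<open>\<pi>\<close> plays no role.  Weak duality: the Fenchel--Young inequality integrated along the
  likelihood ratio bounds \<open>Q A\<close> by every tolerance level.  Strong duality: an admissible sampling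
  distribution \<open>P0\<close> has an event \<open>A\<close> with \<open>P0 A \<le> \<delta> = P A\<close> (threshold the likelihood ratio at \<open>1\<close>
  and adjust its mass along a coordinate), and tilting \<open>P\<close> by a density that is constant on \<open>A\<close> and
  on its complement gives every \<open>q\<close> whose binary divergence from \<open>\<delta>\<close> is at most \<open>lam\<close>.  Hence, if the
  worst-case value \<open>m\<close> of \<open>P0\<close> is below \<open>1\<close>, its binary divergence is at least \<open>lam\<close>, and
  \<open>z0 + z = \<phi>' (m / \<delta>)\<close>, \<open>z0 = \<phi>' ((1 - m) / (1 - \<delta>))\<close> certifies that \<open>m\<close> is a tolerance level.
  By weak duality \<open>m\<close> is then at least the worst-case value of \<open>P\<close>, which gives optimality; for
  \<open>P0 = P\<close> it is the least level.
\<close>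

section \<open>The conjugate of the generator and the constraints on the multipliers\<close>

lemma phi_conj_ge:
  assumes "0 \<le> x"
  shows "ereal (t * x - \<phi> x) \<le> phi_conj \<phi> t"
proof -
  have "ereal (t * x - \<phi> x) = ereal (t * x) - extend_phi \<phi> x"
    using assms by (simp add: extend_phi_def)
  then show ?thesis
    unfolding phi_conj_def by (auto intro: SUP_upper)
qed

lemma phi_conj_le:
  assumes "\<And>x. 0 \<le> x \<Longrightarrow> t * x - \<phi> x \<le> c"
  shows "phi_conj \<phi> t \<le> ereal c"
  unfolding phi_conj_def by (rule SUP_least) (auto simp: extend_phi_def assms)

lemma phi_conj_mono:
  assumes "s \<le> t"
  shows "phi_conj \<phi> s \<le> phi_conj \<phi> t"
  unfolding phi_conj_def
proof (rule SUP_mono)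
  fix x
  have "s * x \<le> t * x" if "0 \<le> x"
    using that assms by (rule mult_right_mono[rotated])
  then show "\<exists>y\<in>UNIV. ereal (s * x) - extend_phi \<phi> x \<le> ereal (t * y) - extend_phi \<phi> y"
    by (intro bexI[of _ x]) (auto simp: extend_phi_def)
qed

lemma phi_conj_finite:
  assumes "phi_conj \<phi> t < \<infinity>"
  obtains c where "phi_conj \<phi> t = ereal c"
  using assms phi_conj_ge[of 1 t \<phi>] by (cases "phi_conj \<phi> t") auto

lemma phi_conj_ge_self:
  assumes "\<phi> 1 = 0"
  shows "ereal t \<le> phi_conj \<phi> t"
  using phi_conj_ge[of 1 t \<phi>] assms by simp

lemma phi_conj_nonpos:
  assumes "\<forall>x\<ge>0. 0 \<le> \<phi> x" "t \<le> 0"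
  shows "phi_conj \<phi> t \<le> 0"
  unfolding zero_ereal_def
proof (rule phi_conj_le)
  fix x :: real assume "0 \<le> x"
  then show "t * x - \<phi> x \<le> 0"
    using assms mult_nonpos_nonneg[of t x] by fastforce
qed

lemma le_m_upper:
  assumes "phi_conj \<phi> t < \<infinity>"
  shows "ereal t \<le> m_upper (phi_conj \<phi>)"
  unfolding m_upper_def
proof (rule Inf_greatest, clarify)
  fix m assume "phi_conj \<phi> m = \<infinity>"
  then show "ereal t \<le> ereal m"
    using assms phi_conj_mono[of m t \<phi>] by (cases "t \<le> m") auto
qed

text \<open>Constancy up to some \<open>m > 0\<close> would equate the value at \<open>0\<close>,
  which is nonpositive, with the value at \<open>m\<close>, which is at least \<open>m\<close>.
  Hence every positive \<open>z0 + z\<close> meets the lower constraint.\<close>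

lemma m_lower_nonpos:
  assumes "\<phi> 1 = 0" "\<forall>x\<ge>0. 0 \<le> \<phi> x"
  shows "m_lower (phi_conj \<phi>) \<le> 0"
  unfolding m_lower_def
proof (rule Sup_least, clarify)
  fix m c assume const: "\<forall>t\<le>m. phi_conj \<phi> t = ereal c"
  show "ereal m \<le> 0"
  proof (rule ccontr)
    assume "\<not> ereal m \<le> 0"
    then have m: "0 < m" by simp
    then have "phi_conj \<phi> m = phi_conj \<phi> 0" using const by simp
    also have "\<dots> \<le> 0" using assms(2) by (rule phi_conj_nonpos) simp
    finally show False
      using order_trans[OF phi_conj_ge_self[of \<phi> m, OF assms(1)]] m by fastforce
  qed
qed

text \<open>Since \<open>\<phi> 1 = 0\<close> and \<open>\<phi>\<close> is nonnegative, convexity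
  makes \<open>\<phi> x / x\<close> nondecreasing for \<open>x \<ge> 1\<close>, so the limit
  defining \<open>ell\<close> exists in the extended reals. Fenchel--Young divided by
  \<open>x\<close> bounds it below by \<open>t\<close>.\<close>

lemma le_ell:
  assumes gen: "divergence_generator \<phi>" and fin: "phi_conj \<phi> t < \<infinity>"
  shows "ereal t \<le> ell \<phi>"
proof -
  have cvx: "convex_on {0..} \<phi>" and one: "\<phi> 1 = 0" and nn: "\<And>x. 0 \<le> x \<Longrightarrow> 0 \<le> \<phi> x"
    using gen by (auto simp: divergence_generator_def)
  define g where "g x = extend_phi \<phi> x / ereal x" for x
  have g: "g x = ereal (\<phi> x / x)" if "1 \<le> x" for x
    using that by (simp add: g_def extend_phi_def)
  have mono: "\<phi> x / x \<le> \<phi> y / y" if "1 \<le> x" "x < y" for x y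
  proof -
    \<comment> \<open>The weight that writes \<open>x\<close> as a convex combination of
      \<open>1\<close>, a zero of \<open>\<phi>\<close>, and \<open>y\<close>.\<close>
    define u where "u = (x - 1) / (y - 1)"
    have u: "0 \<le> u" "u \<le> 1" "u \<le> x / y"
      using that by (auto simp: u_def field_simps)
    have "u * (y - 1) = x - 1" using that by (simp add: u_def)
    then have x: "x = (1 - u) * 1 + u * y" by (simp add: algebra_simps)
    have "\<phi> ((1 - u) *\<^sub>R 1 + u *\<^sub>R y) \<le> (1 - u) * \<phi> 1 + u * \<phi> y"
      using u that by (intro convex_onD[OF cvx]) auto
    then have "\<phi> x \<le> u * \<phi> y" using x one by simp
    also have "\<dots> \<le> x / y * \<phi> y"
      using u nn[of y] that by (intro mult_right_mono) auto
    finally show ?thesis using that by (simp add: field_simps)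
  qed
  define S where "S = (SUP x\<in>{1..}. g x)"
  have "(g \<longlongrightarrow> S) at_top"
  proof (rule increasing_tendsto)
    show "\<forall>\<^sub>F x in at_top. g x \<le> S"
      using eventually_ge_at_top[of 1] by eventually_elim (auto simp: S_def intro: SUP_upper)
    fix a assume "a < S"
    then obtain x where x: "1 \<le> x" "a < g x" by (auto simp: S_def less_SUP_iff)
    show "\<forall>\<^sub>F y in at_top. a < g y"
      using eventually_gt_at_top[of x]
    proof eventually_elim
      case (elim y)
      then have "g x \<le> g y" using g mono x by simp
      then show ?case using x(2) by simp
    qed
  qed
  then have lim: "(g \<longlongrightarrow> ell \<phi>) at_top"
    by (simp add: ell_def g_def[abs_def] tendsto_Lim)
  obtain c where c: "phi_conj \<phi> t = ereal c" using fin by (rule phi_conj_finite)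
  have "((\<lambda>x::real. ereal (t - c / x)) \<longlongrightarrow> ereal t) at_top"
  proof -
    have "((\<lambda>x::real. t - c / x) \<longlongrightarrow> t - 0) at_top"
      by (intro tendsto_intros tendsto_divide_0[OF tendsto_const] filterlim_at_top_imp_at_infinity
          filterlim_ident)
    then show ?thesis by simp
  qed
  then show ?thesis
  proof (rule tendsto_le[OF trivial_limit_at_top_linorder lim])
    show "\<forall>\<^sub>F x in at_top. ereal (t - c / x) \<le> g x"
      using eventually_ge_at_top[of 1]
    proof eventually_elim
      case (elim x)
      have "t * x - c \<le> \<phi> x" using phi_conj_ge[of x t \<phi>] c elim by simp
      then have "(t * x - c) / x \<le> \<phi> x / x" using elim by (intro divide_right_mono) auto
      then show ?case using elim by (simp add: g diff_divide_distrib)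
    qed
  qed
qed

section \<open>Tangents and strict positivity of the generator\<close>

lemma generator_derivative:
  assumes "divergence_generator \<phi>"
  obtains \<phi>' where "\<And>x. 0 < x \<Longrightarrow> (\<phi> has_real_derivative \<phi>' x) (at x)"
  using assms unfolding divergence_generator_def by blast

lemma generator_tangent:
  assumes "divergence_generator \<phi>" "0 < x" "(\<phi> has_real_derivative D) (at x)" "0 \<le> y"
  shows "\<phi> x + D * (y - x) \<le> \<phi> y"
proof -
  have "\<phi> y - \<phi> x \<ge> D * (y - x)"
    using assms
    by (intro convex_on_imp_above_tangent[where A = "{0..}"])
      (auto simp: divergence_generator_def intro: has_field_derivative_at_within)
  then show ?thesis by simp
qed

text \<open>A second zero would make \<open>\<phi>\<close> vanish between it and \<open>1\<close>;
  then \<open>\<phi>'\<close> vanishes there too, and its one-sided difference quotients at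
  \<open>1\<close> are zero, against \<open>\<phi>'' 1 \<noteq> 0\<close>.\<close>

lemma generator_pos:
  assumes gen: "divergence_generator \<phi>" and x: "0 \<le> x" "x \<noteq> 1"
  shows "0 < \<phi> x"
proof (rule ccontr)
  assume "\<not> 0 < \<phi> x"
  obtain \<phi>' \<phi>'' where cvx: "convex_on {0..} \<phi>" and one: "\<phi> 1 = 0" and nn: "\<And>x. 0 \<le> x \<Longrightarrow> 0 \<le> \<phi> x"
    and d1: "\<And>x. 0 < x \<Longrightarrow> (\<phi> has_real_derivative \<phi>' x) (at x)"
    and d2: "\<And>x. 0 < x \<Longrightarrow> (\<phi>' has_real_derivative \<phi>'' x) (at x)" and "\<phi>'' 1 \<noteq> 0"
    using gen unfolding divergence_generator_def by auto
  have x0: "\<phi> x = 0" using \<open>\<not> 0 < \<phi> x\<close> nn[OF x(1)] by simp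
  define I where "I = {min x 1<..<max x 1}"
  have zero: "\<phi> y = 0" if "y \<in> I" for y
  proof -
    have "y \<in> closed_segment x 1"
      using that by (auto simp: I_def closed_segment_eq_real_ivl)
    then obtain u where u: "0 \<le> u" "u \<le> 1" "y = (1 - u) *\<^sub>R x + u *\<^sub>R 1"
      by (auto simp: closed_segment_def)
    have "\<phi> y \<le> (1 - u) * \<phi> x + u * \<phi> 1"
      unfolding u(3) using u(1,2) x by (intro convex_onD[OF cvx]) auto
    moreover have "0 \<le> y" using that x by (auto simp: I_def)
    ultimately show ?thesis using nn[of y] x0 one by simp
  qed
  have d_zero: "\<phi>' y = 0" if "y \<in> I" for y
  proof -
    have "0 < y" using that x by (auto simp: I_def)
    have "((\<lambda>_. 0) has_real_derivative \<phi>' y) (at y)"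
      using d1[OF \<open>0 < y\<close>] by (rule has_field_derivative_transform_within_open[where S = I])
        (use that zero in \<open>auto simp: I_def\<close>)
    then show ?thesis using DERIV_const DERIV_unique by blast
  qed
  \<comment> \<open>The point \<open>1\<close> is only an endpoint of the open interval
    \<open>I\<close>; minimality of \<open>\<phi>\<close> at \<open>1\<close> settles it.\<close>
  have "\<phi>' 1 = 0"
    using d1[of 1] nn one
    by (intro DERIV_local_min[of \<phi> "\<phi>' 1" 1 1]) auto
  have "((\<lambda>y. (\<phi>' y - \<phi>' 1) / (y - 1)) \<longlongrightarrow> \<phi>'' 1) (at 1 within I)"
    using d2[of 1] has_field_derivative_at_within[of \<phi>' "\<phi>'' 1" 1 I]
    by (simp add: has_field_derivative_iff)
  moreover have "((\<lambda>y. (\<phi>' y - \<phi>' 1) / (y - 1)) \<longlongrightarrow> 0) (at 1 within I)"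
    by (rule tendsto_eventually) (auto simp: eventually_at_filter d_zero \<open>\<phi>' 1 = 0\<close>)
  moreover have "at 1 within I \<noteq> bot"
    using x by (cases "x < 1") (auto simp: I_def at_within_eq_bot_iff min_def max_def
        islimpt_greaterThanLessThan1 islimpt_greaterThanLessThan2 trivial_limit_within)
  ultimately show False using \<open>\<phi>'' 1 \<noteq> 0\<close> tendsto_unique by blast
qed

text \<open>Equality case of Fenchel--Young: the graph lies above its tangent at \<open>x\<close>,
  so the supremum is attained there.\<close>

lemma phi_conj_derivative:
  assumes "divergence_generator \<phi>" "0 < x" "(\<phi> has_real_derivative D) (at x)"
  shows "phi_conj \<phi> D = ereal (D * x - \<phi> x)"
proof (rule antisym)
  show "phi_conj \<phi> D \<le> ereal (D * x - \<phi> x)"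
    by (rule phi_conj_le) (use generator_tangent[OF assms] in \<open>simp add: algebra_simps\<close>)
  show "ereal (D * x - \<phi> x) \<le> phi_conj \<phi> D"
    using assms(2) by (intro phi_conj_ge) simp
qed

text \<open>At \<open>1\<close> the tangent at \<open>x\<close> is at most
  \<open>\<phi> 1 = 0\<close>, while \<open>\<phi> x > 0\<close>. This places the dual multipliers
  on the correct sides of \<open>0\<close>.\<close>

lemma generator_derivative_sign:
  assumes "divergence_generator \<phi>" "0 < x" "x \<noteq> 1" "(\<phi> has_real_derivative D) (at x)"
  shows "0 < D * (x - 1)"
  using generator_tangent[OF assms(1,2,4), of 1] generator_pos[OF assms(1), of x] assms
  by (simp add: divergence_generator_def algebra_simps)

section \<open>Bounds on the adjusted tolerance\<close>

text \<open>A single feasible pair bounds the infimum from above. The signs of \<open>z0\<close> and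
  \<open>z0 + z\<close> give \<open>d \<le> 0 < c\<close>, hence a positive denominator.\<close>

lemma le_adjusted_tol:
  assumes gen: "divergence_generator \<phi>"
    and \<pi>: "\<pi> \<in> {-\<infinity>, 0, 1}" and z: "z0 \<le> 0" "0 < z0 + z"
    and c: "phi_conj \<phi> (z0 + z) = ereal c" and d: "phi_conj \<phi> z0 = ereal d"
    and le: "c - z0 - \<epsilon> * z + lam \<le> (1 - x) * (c - d)"
  shows "ereal x \<le> adjusted_tol \<pi> \<epsilon> lam \<phi>"
proof -
  have one: "\<phi> 1 = 0" and nn: "\<forall>x\<ge>0. 0 \<le> \<phi> x"
    using gen by (auto simp: divergence_generator_def)
  have "d < c"
    using phi_conj_ge_self[of \<phi> "z0 + z", OF one] phi_conj_nonpos[OF nn z(1)] c d z by simp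
  define q where "q = (c - z0 - \<epsilon> * z + lam) / (c - d)"
  have "q \<le> 1 - x"
    using le \<open>d < c\<close> by (simp add: q_def pos_divide_le_eq)
  have "ereal z0 + \<pi> * ereal z \<le> ereal (z0 + z)"
    using \<pi> z by auto
  also have "\<dots> \<le> ell \<phi>"
    by (rule le_ell[OF gen]) (simp add: c)
  finally have ell: "ereal z0 + \<pi> * ereal z \<le> ell \<phi>" .
  have "m_lower (phi_conj \<phi>) \<le> 0" using one nn by (rule m_lower_nonpos)
  also have "0 \<le> ereal (z0 + z)" using z by simp
  finally have low: "m_lower (phi_conj \<phi>) \<le> ereal (z0 + z)" .
  let ?S = "{(phi_conj \<phi> (z0 + z) - ereal z0 - ereal (\<epsilon> * z) + ereal lam) /
                     (phi_conj \<phi> (z0 + z) - phi_conj \<phi> z0) | z0 z.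
                   0 < z \<and> ereal z0 + \<pi> * ereal z \<le> ell \<phi> \<and>
                   m_lower (phi_conj \<phi>) \<le> ereal (z0 + z) \<and>
                   ereal (z0 + z) \<le> m_upper (phi_conj \<phi>) \<and>
                   phi_conj \<phi> (z0 + z) < \<infinity>}"
  have "ereal q \<in> ?S"
    using z ell low le_m_upper[of \<phi> "z0 + z"] c d \<open>d < c\<close>
    by (intro CollectI exI[of _ z0] exI[of _ z]) (simp add: q_def)
  then have "Inf ?S \<le> ereal (1 - x)"
    by (rule order_trans[OF Inf_lower]) (use \<open>q \<le> 1 - x\<close> in simp)
  then have "1 - ereal (1 - x) \<le> 1 - Inf ?S"
    by (intro ereal_minus_mono) auto
  then show ?thesis
    unfolding adjusted_tol_def by (intro max.coboundedI1) (simp add: one_ereal_def)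
qed

text \<open>Passes from an inequality cleared of denominators to a bound on every quotient,
  including those with a vanishing denominator.\<close>

lemma adjusted_tol_le:
  assumes one: "\<phi> 1 = 0" and "0 < lam" "\<epsilon> \<le> 1" "0 \<le> b"
    and le: "\<And>z0 z c d. \<lbrakk>0 < z; phi_conj \<phi> (z0 + z) = ereal c; phi_conj \<phi> z0 = ereal d\<rbrakk>
      \<Longrightarrow> (1 - b) * (c - d) \<le> c - z0 - \<epsilon> * z + lam"
  shows "adjusted_tol \<pi> \<epsilon> lam \<phi> \<le> ereal b"
proof -
  let ?q = "\<lambda>z0 z. (phi_conj \<phi> (z0 + z) - ereal z0 - ereal (\<epsilon> * z) + ereal lam) /
                     (phi_conj \<phi> (z0 + z) - phi_conj \<phi> z0)"
  have quot: "ereal (1 - b) \<le> ?q z0 z" if z: "0 < z" and fin: "phi_conj \<phi> (z0 + z) < \<infinity>" for z0 z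
  proof -
    have mono: "phi_conj \<phi> z0 \<le> phi_conj \<phi> (z0 + z)" using z by (intro phi_conj_mono) simp
    obtain c where c: "phi_conj \<phi> (z0 + z) = ereal c" using fin by (rule phi_conj_finite)
    obtain d where d: "phi_conj \<phi> z0 = ereal d"
      using fin mono by (metis phi_conj_finite order_le_less_trans)
    have "d \<le> c" using mono c d by simp
    \<comment> \<open>From \<open>z0 + z \<le> c\<close> and \<open>\<epsilon> \<le> 1\<close> the
      numerator is at least \<open>lam\<close>; its positivity makes a zero denominator yield
      \<open>\<infinity>\<close>.\<close>
    have num: "0 < c - z0 - \<epsilon> * z + lam"
    proof -
      have "\<epsilon> * z \<le> 1 * z" using assms(3) z by (intro mult_right_mono) auto
      then show ?thesis
        using phi_conj_ge_self[of \<phi> "z0 + z", OF one] c assms(2) by simp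
    qed
    show ?thesis
    proof (cases "d = c")
      case True
      then show ?thesis using c d num by (simp add: divide_ereal_def)
    next
      case False
      then have "1 - b \<le> (c - z0 - \<epsilon> * z + lam) / (c - d)"
        using le[OF z c d] \<open>d \<le> c\<close> by (simp add: pos_le_divide_eq)
      then show ?thesis using c d False by simp
    qed
  qed
  let ?S = "{?q z0 z | z0 z. 0 < z \<and> ereal z0 + \<pi> * ereal z \<le> ell \<phi> \<and>
                   m_lower (phi_conj \<phi>) \<le> ereal (z0 + z) \<and>
                   ereal (z0 + z) \<le> m_upper (phi_conj \<phi>) \<and>
                   phi_conj \<phi> (z0 + z) < \<infinity>}"
  have "ereal (1 - b) \<le> Inf ?S"
    using quot by (intro Inf_greatest) blast
  then have "1 - Inf ?S \<le> 1 - ereal (1 - b)"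
    by (intro ereal_minus_mono) auto
  then show ?thesis
    unfolding adjusted_tol_def using \<open>0 \<le> b\<close> by (intro max.boundedI) (auto simp: one_ereal_def)
qed

text \<open>With \<open>z0 + z = t\<close> fixed, the numerator
  \<open>c - t - (\<epsilon> - 1) * z + lam\<close> tends to minus infinity as \<open>z\<close>
  grows, while the denominator stays between \<open>0\<close> and
  \<open>c + \<phi> 0\<close>.\<close>

lemma gt_one_in_tol_levels:
  assumes gen: "divergence_generator \<phi>" and \<pi>: "\<pi> \<in> {-\<infinity>, 0, 1}" and "1 < \<epsilon>"
  shows "\<epsilon> \<in> tol_levels \<pi> x lam \<phi>"
proof -
  obtain \<phi>' where d1: "\<And>x. 0 < x \<Longrightarrow> (\<phi> has_real_derivative \<phi>' x) (at x)"
    using gen by (rule generator_derivative) blast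
  have nn: "\<forall>x\<ge>0. 0 \<le> \<phi> x" using gen by (auto simp: divergence_generator_def)
  \<comment> \<open>A slope beyond \<open>1\<close> is positive and has a finite conjugate.\<close>
  define t where "t = \<phi>' 2"
  have "0 < t" using generator_derivative_sign[OF gen, of 2] d1[of 2] by (simp add: t_def)
  obtain c where c: "phi_conj \<phi> t = ereal c"
    using phi_conj_derivative[OF gen, of 2] d1[of 2] by (auto simp: t_def)
  \<comment> \<open>The first entry gives \<open>t - z \<le> 0\<close>; the second brings the
    numerator down to at most \<open>- \<bar>1 - x\<bar> * (c + \<phi> 0)\<close>.\<close>
  define z where "z = max t ((c - t + lam + \<bar>1 - x\<bar> * (c + \<phi> 0)) / (\<epsilon> - 1))"
  have z0: "t - z \<le> 0" by (simp add: z_def)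
  obtain d where d: "phi_conj \<phi> (t - z) = ereal d"
    by (rule phi_conj_finite[of \<phi> "t - z"]) (use phi_conj_nonpos[OF nn z0] in auto)
  have "d \<le> c" using phi_conj_mono[of "t - z" t \<phi>] z0 c d \<open>0 < t\<close> by (simp add: z_def)
  have "- \<phi> 0 \<le> d" using phi_conj_ge[of 0 "t - z" \<phi>] d by simp
  have "c - t + lam + \<bar>1 - x\<bar> * (c + \<phi> 0) \<le> z * (\<epsilon> - 1)"
    using \<open>1 < \<epsilon>\<close> by (simp add: pos_divide_le_eq[symmetric] z_def)
  moreover have "- (1 - x) * (c - d) \<le> \<bar>1 - x\<bar> * (c + \<phi> 0)"
    using \<open>d \<le> c\<close> \<open>- \<phi> 0 \<le> d\<close> by (intro mult_mono) auto
  ultimately have "c - (t - z) - \<epsilon> * z + lam \<le> (1 - x) * (c - d)"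
    by (simp add: algebra_simps)
  then have "ereal x \<le> adjusted_tol \<pi> \<epsilon> lam \<phi>"
    using c d z0 \<open>0 < t\<close> by (intro le_adjusted_tol[OF gen \<pi>, of "t - z" z]) auto
  then show ?thesis using \<open>1 < \<epsilon>\<close> by (simp add: tol_levels_def)
qed

section \<open>The two-point divergence and its dual certificate\<close>

text \<open>For \<open>0 < a < 1\<close> and \<open>0 \<le> q \<le> 1\<close> this is the divergence
  between the Bernoulli laws with parameters \<open>a\<close> (the center) and
  \<open>q\<close>.\<close>

definition binary_divergence :: "(real \<Rightarrow> real) \<Rightarrow> real \<Rightarrow> real \<Rightarrow> real" where
  "binary_divergence \<phi> a q = a * \<phi> (q / a) + (1 - a) * \<phi> ((1 - q) / (1 - a))"

text \<open>With derivatives at the two likelihood ratios as multipliers, both Fenchel--Young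
  inequalities are equalities. So \<open>\<delta> * c + (1 - \<delta>) * d\<close> is
  \<open>\<epsilon> * t + (1 - \<epsilon>) * z0\<close> minus the binary divergence, and the
  inequality required of the pair reduces to the hypothesis on \<open>lam\<close>.\<close>

lemma binary_divergence_in_tol_levels:
  assumes gen: "divergence_generator \<phi>" and \<pi>: "\<pi> \<in> {-\<infinity>, 0, 1}"
    and \<delta>: "0 < \<delta>" "\<delta> < \<epsilon>" "\<epsilon> < 1" and D: "lam \<le> binary_divergence \<phi> \<delta> \<epsilon>"
  shows "\<epsilon> \<in> tol_levels \<pi> \<delta> lam \<phi>"
proof -
  obtain \<phi>' where d1: "\<And>x. 0 < x \<Longrightarrow> (\<phi> has_real_derivative \<phi>' x) (at x)"
    using gen by (rule generator_derivative) blast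
  define x where "x = \<epsilon> / \<delta>"
  define y where "y = (1 - \<epsilon>) / (1 - \<delta>)"
  have xy: "1 < x" "0 < y" "y < 1" using \<delta> by (auto simp: x_def y_def field_simps)
  define t where "t = \<phi>' x"
  define z0 where "z0 = \<phi>' y"
  have "0 < t" using generator_derivative_sign[OF gen _ _ d1, of x] xy
    by (simp add: t_def zero_less_mult_iff)
  have "z0 < 0" using generator_derivative_sign[OF gen _ _ d1, of y] xy
    by (simp add: z0_def zero_less_mult_iff)
  define c where "c = t * x - \<phi> x"
  define d where "d = z0 * y - \<phi> y"
  have c: "phi_conj \<phi> t = ereal c" and d: "phi_conj \<phi> z0 = ereal d"
    using phi_conj_derivative[OF gen _ d1] xy by (auto simp: c_def d_def t_def z0_def)
  have \<epsilon>: "\<delta> * x = \<epsilon>" "(1 - \<delta>) * y = 1 - \<epsilon>" using \<delta> by (auto simp: x_def y_def)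
  have "\<delta> * c = t * (\<delta> * x) - \<delta> * \<phi> x" "(1 - \<delta>) * d = z0 * ((1 - \<delta>) * y) - (1 - \<delta>) * \<phi> y"
    by (simp_all add: c_def d_def algebra_simps)
  note this[unfolded \<epsilon>]
  then have "c - z0 - \<epsilon> * (t - z0) + lam \<le> (1 - \<delta>) * (c - d)"
    using D unfolding binary_divergence_def x_def[symmetric] y_def[symmetric]
    by (simp add: algebra_simps)
  then have "ereal \<delta> \<le> adjusted_tol \<pi> \<epsilon> lam \<phi>"
    using c d \<open>0 < t\<close> \<open>z0 < 0\<close> by (intro le_adjusted_tol[OF gen \<pi>, of z0 "t - z0" c d]) auto
  then show ?thesis using \<delta> by (simp add: tol_levels_def)
qed

section \<open>Events of prescribed mass\<close>

lemma coordinate_hyperplane_null: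
  fixes p :: "real ^ 'k \<Rightarrow> real"
  assumes p: "p \<in> borel_measurable borel"
  shows "emeasure (density lborel (\<lambda>y. ennreal (p y))) {y. y $ i = c} = 0"
proof -
  have "{y :: real ^ 'k. y $ i = c} = (+) (c *\<^sub>R axis i 1) ` {y. y $ i = 0}"
    by (auto simp: image_iff axis_def intro!: exI[of _ "_ - c *\<^sub>R axis i 1"])
  then have "negligible {y :: real ^ 'k. y $ i = c}"
    by (simp add: negligible_translation negligible_standard_hyperplane_cart)
  moreover have meas: "{y :: real ^ 'k. y $ i = c} \<in> sets borel" by measurable
  ultimately have "{y :: real ^ 'k. y $ i = c} \<in> null_sets lborel"
    by (simp add: negligible_iff_null_sets null_sets_def)
  then show ?thesis
    using p meas by (auto simp: emeasure_density null_sets_def nn_integral_null_set)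
qed

text \<open>Sweeping \<open>C - B\<close> along a coordinate adds mass continuously, because
  hyperplanes are null; the intermediate value theorem then meets every target.\<close>

lemma intermediate_measure_set:
  fixes p :: "real ^ 'k \<Rightarrow> real" and v :: real
  assumes p: "p \<in> borel_measurable borel" and P: "P = density lborel (\<lambda>y. ennreal (p y))" "prob_space P"
    and B: "B \<in> sets borel" and C: "C \<in> sets borel" and BC: "B \<subseteq> C"
    and v: "measure P B \<le> v" "v \<le> measure P C"
  obtains A where "A \<in> sets borel" "B \<subseteq> A" "A \<subseteq> C" "measure P A = v"
proof -
  interpret P: prob_space P by fact
  have sets[simp, measurable_cong]: "sets P = sets borel" by (simp add: P)
  have space[simp]: "space P = UNIV" by (simp add: P)
  define i :: 'k where "i = undefined"
  define S where "S = C - B"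
  have S[measurable]: "S \<in> sets borel" using B C by (simp add: S_def)
  \<comment> \<open>The coordinate marginal of \<open>P\<close> restricted to \<open>S\<close>: a
    finite measure, in general not of mass one.\<close>
  define N where "N = distr (density P (indicator S)) borel (\<lambda>y. y $ i)"
  have N: "emeasure N X = emeasure P (S \<inter> {y. y $ i \<in> X})" if X[measurable]: "X \<in> sets borel" for X
  proof -
    have "{y. y $ i \<in> X} \<in> sets borel" by measurable
    moreover have "emeasure N X = emeasure (density P (indicator S)) {y. y $ i \<in> X}"
      unfolding N_def by (subst emeasure_distr) (auto simp: vimage_def)
    ultimately show ?thesis by (simp add: emeasure_density nn_integral_indicator' mult.commute
        flip: indicator_inter_arith)
  qed
  have Nm: "measure N X = measure P (S \<inter> {y. y $ i \<in> X})" if "X \<in> sets borel" for X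
    using N[OF that] by (simp add: measure_def)
  have "emeasure N (space N) \<noteq> \<infinity>"
    using N[of UNIV] by (simp add: N_def P.emeasure_eq_measure)
  then interpret N: finite_borel_measure N
    by (intro finite_borel_measure.intro finite_borel_measure_axioms.intro finite_measureI)
      (simp_all add: N_def)
  have tot: "measure N (space N) = measure P C - measure P B"
    using Nm[of UNIV] P.finite_measure_Diff[of C B] B C BC by (simp add: N_def S_def)
  have cont: "isCont (cdf N) c" for c
  proof -
    have "{y :: real ^ 'k. y $ i = c} \<in> sets borel" by measurable
    then have "emeasure P (S \<inter> {y. y $ i = c}) \<le> emeasure P {y. y $ i = c}"
      by (intro emeasure_mono) auto
    also have "\<dots> = 0" unfolding P by (rule coordinate_hyperplane_null[OF p])
    finally show ?thesis unfolding N.isCont_cdf using Nm[of "{c}"] by (simp add: measure_def)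
  qed
  \<comment> \<open>The extreme masses are set apart, since the distribution function of
    \<open>N\<close> may approach them only at infinity.\<close>
  consider "v = measure P B" | "v = measure P C" | "measure P B < v" "v < measure P C"
    using v by linarith
  then show ?thesis
  proof cases
    case 1 then show ?thesis using that[of B] B BC by simp
  next
    case 2 then show ?thesis using that[of C] C BC by simp
  next
    case 3
    define w where "w = v - measure P B"
    have w: "0 < w" "w < measure N (space N)" using 3 tot by (auto simp: w_def)
    obtain a where a: "cdf N a < w"
      using order_tendstoD(2)[OF N.cdf_lim_at_bot w(1)] by (metis eventually_at_bot_linorder order_refl)
    obtain b where b: "w < cdf N b"
      using order_tendstoD(1)[OF N.cdf_lim_at_top w(2)] by (metis eventually_at_top_linorder order_refl)
    have "a \<le> b" using a b N.cdf_nondecreasing[of b a] by linarith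
    then obtain s where s: "cdf N s = w"
      using IVT[of "cdf N" a w b] a b cont by auto
    define A where "A = B \<union> (S \<inter> {y. y $ i \<in> {..s}})"
    have T: "S \<inter> {y. y $ i \<in> {..s}} \<in> sets borel" by measurable
    show ?thesis
    proof (rule that)
      show "A \<in> sets borel" using B T by (simp add: A_def)
      show "B \<subseteq> A" "A \<subseteq> C" using BC by (auto simp: A_def S_def)
      have "measure P A = measure P B + measure P (S \<inter> {y. y $ i \<in> {..s}})"
        unfolding A_def using B T by (intro P.finite_measure_Union) (auto simp: S_def)
      then show "measure P A = v" using s Nm[of "{..s}"] by (simp add: cdf_def w_def)
    qed
  qed
qed

text \<open>Neyman--Pearson: an event of \<open>P\<close>-mass \<open>\<delta>\<close> comparable with \<open>{y. 1 \<le> L y}\<close> has at most that mass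
  under \<open>P0\<close>.\<close>

lemma admissible_sampling_event:
  fixes p :: "real ^ 'k \<Rightarrow> real"
  assumes p: "p \<in> borel_measurable borel" and P: "P = density lborel (\<lambda>y. ennreal (p y))" "prob_space P"
    and adm: "admissible_sampling P P0" and \<delta>: "0 \<le> \<delta>" "\<delta> \<le> 1"
  obtains A where "A \<in> sets borel" "measure P A = \<delta>" "measure P0 A \<le> \<delta>"
proof -
  interpret P: prob_space P by fact
  obtain L where P0: "prob_space P0" and s0: "sets P0 = sets borel"
    and L[measurable]: "L \<in> borel_measurable borel" and dens: "P = density P0 (\<lambda>y. ennreal (L y))"
    using adm by (auto simp: admissible_sampling_def)
  interpret P0: prob_space P0 by fact
  have sets: "sets P = sets borel" by (simp add: P)
  have space: "space P = UNIV" "space P0 = UNIV"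
    using sets_eq_imp_space_eq[OF sets] sets_eq_imp_space_eq[OF s0] by simp_all
  have L0[measurable]: "(\<lambda>y. ennreal (L y)) \<in> borel_measurable P0"
    using L s0 by (simp add: measurable_cong_sets[OF s0 refl])
  have ge: "measure P0 X \<le> measure P X" if X: "X \<in> sets borel" "X \<subseteq> {y. 1 \<le> L y}" for X
  proof -
    have "emeasure P0 X = (\<integral>\<^sup>+y. indicator X y \<partial>P0)" using X s0 by simp
    also have "\<dots> \<le> (\<integral>\<^sup>+y. ennreal (L y) * indicator X y \<partial>P0)"
      using X by (intro nn_integral_mono) (auto simp: indicator_def)
    also have "\<dots> = emeasure P X" using X s0 by (simp add: dens emeasure_density)
    finally show ?thesis by (simp add: P.emeasure_eq_measure P0.emeasure_eq_measure)
  qed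
  have le: "measure P X \<le> measure P0 X" if X: "X \<in> sets borel" "X \<subseteq> {y. L y \<le> 1}" for X
  proof -
    have "emeasure P X = (\<integral>\<^sup>+y. ennreal (L y) * indicator X y \<partial>P0)"
      using X s0 by (simp add: dens emeasure_density)
    also have "\<dots> \<le> (\<integral>\<^sup>+y. indicator X y \<partial>P0)"
      using X by (intro nn_integral_mono) (auto simp: indicator_def)
    also have "\<dots> = emeasure P0 X" using X s0 by simp
    finally show ?thesis by (simp add: P.emeasure_eq_measure P0.emeasure_eq_measure)
  qed
  define E where "E = {y. 1 \<le> L y}"
  have E: "E \<in> sets borel" unfolding E_def by measurable
  show ?thesis
  proof (cases "\<delta> \<le> measure P E")
    case True
    obtain A where A: "A \<in> sets borel" "A \<subseteq> E" "measure P A = \<delta>"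
      using intermediate_measure_set[OF p P, of "{}" E \<delta>] E \<delta> True by auto
    then show ?thesis using that[of A] ge[of A] by (simp add: E_def)
  next
    case False
    obtain A where A: "A \<in> sets borel" "E \<subseteq> A" "measure P A = \<delta>"
      using intermediate_measure_set[OF p P, of E UNIV \<delta>] E \<delta> False P.prob_space space by auto
    \<comment> \<open>Here \<open>L < 1\<close> off \<open>A\<close>, so the comparison is made on
      the complement and carried back by total mass one.\<close>
    have "measure P (UNIV - A) \<le> measure P0 (UNIV - A)"
      using A by (intro le) (force simp: E_def)+
    then have "measure P0 A \<le> \<delta>"
      using A P.prob_compl[of A] P0.prob_compl[of A] sets s0 space by simp
    then show ?thesis using that A by simp
  qed
qed

section \<open>Divergence along densities: tilting and weak duality\<close>

lemma phi_divergence_density: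
  assumes "prob_space P" and f: "f \<in> borel_measurable P" "\<And>y. 0 \<le> f y"
  shows "phi_divergence \<phi> P (density P (\<lambda>y. ennreal (f y))) = (\<integral>\<^sup>+y. ennreal (\<phi> (f y)) \<partial>P)"
proof -
  interpret P: prob_space P by fact
  have "AE y in P. ennreal (f y) = RN_deriv P (density P (\<lambda>y. ennreal (f y))) y"
    using f by (intro P.RN_deriv_unique) auto
  then show ?thesis
    unfolding phi_divergence_def
  proof (intro nn_integral_cong_AE, elim AE_mp, intro AE_I2 impI)
    fix y assume "ennreal (f y) = RN_deriv P (density P (\<lambda>y. ennreal (f y))) y"
    then show "e2ennreal (extend_phi \<phi> (enn2real (RN_deriv P (density P (\<lambda>y. ennreal (f y))) y))) =
        ennreal (\<phi> (f y))"
      using f(2)[of y] by (simp flip: \<open>ennreal (f y) = _\<close> add: extend_phi_def e2ennreal_ereal)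
  qed
qed

text \<open>The factors \<open>u\<close> and \<open>w\<close> rescale the masses of \<open>A\<close>
  and of its complement to \<open>q\<close> and \<open>1 - q\<close>; for a density with only these
  two values the divergence collapses to the binary one.\<close>

lemma two_point_tilting:
  assumes P: "prob_space P" and A: "A \<in> sets P" "measure P A = \<delta>" and \<delta>: "0 < \<delta>" "\<delta> < 1"
    and q: "0 \<le> q" "q \<le> 1" and nn: "\<forall>x\<ge>0. 0 \<le> \<phi> x"
    and D: "binary_divergence \<phi> \<delta> q \<le> lam"
  obtains Q where "Q \<in> phi_ball \<phi> P lam" "measure Q A = q"
proof -
  interpret P: prob_space P by fact
  define u where "u = q / \<delta>"
  define w where "w = (1 - q) / (1 - \<delta>)"
  have uw: "0 \<le> u" "0 \<le> w" "u * \<delta> = q" "w * (1 - \<delta>) = 1 - q"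
    using \<delta> q by (auto simp: u_def w_def)
  define f where "f y = (if y \<in> A then u else w)" for y
  define Q where "Q = density P (\<lambda>y. ennreal (f y))"
  have f[measurable]: "f \<in> borel_measurable P" unfolding f_def using A by measurable
  have Ac: "measure P (space P - A) = 1 - \<delta>" using A by (simp add: P.prob_compl)
  \<comment> \<open>Used with the identity for normalization and with \<open>\<phi>\<close> for the
    divergence.\<close>
  have int: "(\<integral>\<^sup>+y. ennreal (h (f y)) \<partial>P) = ennreal (h u * \<delta> + h w * (1 - \<delta>))"
    if "0 \<le> h u" "0 \<le> h w" for h :: "real \<Rightarrow> real"
  proof -
    have "(\<integral>\<^sup>+y. ennreal (h (f y)) \<partial>P) =
        (\<integral>\<^sup>+y. ennreal (h u) * indicator A y + ennreal (h w) * indicator (space P - A) y \<partial>P)"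
      by (intro nn_integral_cong) (auto simp: f_def indicator_def)
    also have "\<dots> = ennreal (h u) * emeasure P A + ennreal (h w) * emeasure P (space P - A)"
      using A by (subst nn_integral_add) (auto simp: nn_integral_cmult_indicator)
    also have "\<dots> = ennreal (h u * \<delta> + h w * (1 - \<delta>))"
      using A(2) Ac that \<delta> by (simp add: P.emeasure_eq_measure ennreal_mult ennreal_plus)
    finally show ?thesis .
  qed
  have "emeasure Q (space Q) = 1"
    using int[of "\<lambda>x. x"] uw by (simp add: Q_def emeasure_density cong: nn_integral_cong)
  then have Qp: "prob_space Q" by (rule prob_spaceI)
  have "phi_divergence \<phi> P Q = (\<integral>\<^sup>+y. ennreal (\<phi> (f y)) \<partial>P)"
    unfolding Q_def by (rule phi_divergence_density[OF P f]) (simp add: f_def uw)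
  also have "\<dots> = ennreal (\<phi> u * \<delta> + \<phi> w * (1 - \<delta>))"
    using uw nn by (intro int) auto
  also have "\<phi> u * \<delta> + \<phi> w * (1 - \<delta>) = binary_divergence \<phi> \<delta> q"
    by (simp add: binary_divergence_def u_def w_def mult.commute)
  finally have div: "phi_divergence \<phi> P Q \<le> ennreal lam" using D by (simp add: ennreal_leI)
  have "absolutely_continuous P Q"
    unfolding Q_def by (rule absolutely_continuousI_density) simp
  then have ball: "Q \<in> phi_ball \<phi> P lam" using Qp div by (simp add: phi_ball_def Q_def)
  have "emeasure Q A = (\<integral>\<^sup>+y. ennreal u * indicator A y \<partial>P)"
    unfolding Q_def using A by (subst emeasure_density) (auto intro!: nn_integral_cong simp: f_def indicator_def)
  also have "\<dots> = ennreal q"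
    using A uw \<delta> by (simp add: nn_integral_cmult_indicator P.emeasure_eq_measure flip: ennreal_mult)
  finally have "measure Q A = q" using q by (simp add: measure_def)
  with ball show ?thesis by (rule that)
qed

text \<open>Fenchel--Young inequality \<open>t x - \<phi> x \<le> \<phi>\<^sup>* t\<close>, integrated along the likelihood ratio with
  \<open>t = z0 + z\<close> on \<open>A\<close> and \<open>t = z0\<close> off \<open>A\<close>.\<close>

lemma phi_ball_event_bound:
  assumes P: "prob_space P" and gen: "divergence_generator \<phi>" and lam: "0 \<le> lam"
    and Q: "Q \<in> phi_ball \<phi> P lam" and A: "A \<in> sets P"
    and c: "phi_conj \<phi> (z0 + z) = ereal c" and d: "phi_conj \<phi> z0 = ereal d"
  shows "z0 + z * measure Q A - lam \<le> measure P A * c + (1 - measure P A) * d"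
proof -
  interpret P: prob_space P by fact
  have Qp: "prob_space Q" and sets: "sets Q = sets P" and ac: "absolutely_continuous P Q"
    and div: "phi_divergence \<phi> P Q \<le> ennreal lam"
    using Q by (auto simp: phi_ball_def)
  interpret Q: prob_space Q by fact
  have nn: "\<And>x. 0 \<le> x \<Longrightarrow> 0 \<le> \<phi> x" and cont: "continuous_on {0..} \<phi>"
    using gen by (auto simp: divergence_generator_def)
  define f where "f y = enn2real (RN_deriv P Q y)" for y
  have f[measurable]: "f \<in> borel_measurable P" unfolding f_def by measurable
  have f0: "0 \<le> f y" for y by (simp add: f_def)
  \<comment> \<open>As \<open>enn2real\<close> sends \<open>\<infinity>\<close> to \<open>0\<close>,
    almost sure finiteness is needed for \<open>f\<close> to be a density of
    \<open>Q\<close>.\<close>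
  have "AE y in P. RN_deriv P Q y \<noteq> \<infinity>"
    using Q.sigma_finite_measure_axioms ac sets by (rule P.RN_deriv_finite)
  then have "AE y in P. ennreal (f y) = RN_deriv P Q y"
    by eventually_elim (simp add: f_def less_top)
  then have "density P (\<lambda>y. ennreal (f y)) = density P (RN_deriv P Q)"
    by (intro density_cong) auto
  also have "\<dots> = Q" using ac sets by (rule P.density_RN_deriv)
  finally have dens: "Q = density P (\<lambda>y. ennreal (f y))" ..
  have f_int: "integrable P (\<lambda>y. f y * indicator X y)"
    and f_eq: "(\<integral>y. f y * indicator X y \<partial>P) = measure Q X" if X[measurable]: "X \<in> sets P" for X
  proof -
    have "(\<integral>\<^sup>+y. ennreal (f y * indicator X y) \<partial>P) = emeasure Q X"
      unfolding dens using X f0 by (subst emeasure_density) (auto intro!: nn_integral_cong simp: indicator_def)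
    then have "(\<integral>\<^sup>+y. ennreal (f y * indicator X y) \<partial>P) = ennreal (measure Q X)"
      by (simp add: Q.emeasure_eq_measure)
    then have "has_bochner_integral P (\<lambda>y. f y * indicator X y) (measure Q X)"
      using f0 by (intro has_bochner_integral_nn_integral) auto
    then show "integrable P (\<lambda>y. f y * indicator X y)"
      "(\<integral>y. f y * indicator X y \<partial>P) = measure Q X"
      by (auto simp: has_bochner_integral_iff)
  qed
  \<comment> \<open>Continuity is known on the closed half line; \<open>max 0\<close> extends it to
    the real line without changing the values along \<open>f\<close>.\<close>
  have "(\<lambda>x. \<phi> (max 0 x)) \<in> borel_measurable borel"
    by (intro borel_measurable_continuous_onI continuous_on_compose2[OF cont] continuous_intros) auto
  then have "(\<lambda>y. \<phi> (max 0 (f y))) \<in> borel_measurable P"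
    by (rule measurable_compose[OF f])
  then have \<phi>f[measurable]: "(\<lambda>y. \<phi> (f y)) \<in> borel_measurable P" using f0 by (simp add: max_absorb2)
  have \<phi>le: "(\<integral>\<^sup>+y. ennreal (\<phi> (f y)) \<partial>P) \<le> ennreal lam"
    using div f f0 by (subst (asm) dens) (simp add: phi_divergence_density[OF P])
  then have \<phi>int: "integrable P (\<lambda>y. \<phi> (f y))"
    using nn f0 by (intro integrableI_nonneg) (auto intro: order_le_less_trans)
  have "ennreal (\<integral>y. \<phi> (f y) \<partial>P) \<le> ennreal lam"
    using \<phi>le \<phi>int nn f0 by (simp add: nn_integral_eq_integral)
  then have \<phi>lam: "(\<integral>y. \<phi> (f y) \<partial>P) \<le> lam" using lam by simp
  have "f y * z0 + z * (f y * indicator A y) - \<phi> (f y) \<le> d + (c - d) * indicator A y" for y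
    using phi_conj_ge[OF f0[of y], of "z0 + z" \<phi>] phi_conj_ge[OF f0[of y], of z0 \<phi>] c d
    by (auto simp: indicator_def algebra_simps)
  moreover have fi: "integrable P f" "(\<integral>y. f y \<partial>P) = 1"
  proof -
    have "integrable P (\<lambda>y. f y * indicator (space P) y) = integrable P f"
      "(\<integral>y. f y * indicator (space P) y \<partial>P) = (\<integral>y. f y \<partial>P)"
      by (auto intro!: Bochner_Integration.integrable_cong Bochner_Integration.integral_cong)
    then show "integrable P f" "(\<integral>y. f y \<partial>P) = 1"
      using f_int[of "space P"] f_eq[of "space P"] Q.prob_space sets_eq_imp_space_eq[OF sets] by auto
  qed
  ultimately have "(\<integral>y. f y * z0 + z * (f y * indicator A y) - \<phi> (f y) \<partial>P)
      \<le> (\<integral>y. d + (c - d) * indicator A y \<partial>P)"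
    using f_int[OF A] \<phi>int A
    by (intro integral_mono) (auto simp: P.emeasure_eq_measure sets.Int_space_eq2)
  also have "\<dots> = d + (c - d) * measure P A"
    using A by (subst Bochner_Integration.integral_add)
      (auto simp: P.prob_space P.emeasure_eq_measure sets.Int_space_eq2)
  also have "(\<integral>y. f y * z0 + z * (f y * indicator A y) - \<phi> (f y) \<partial>P) =
      z0 + z * measure Q A - (\<integral>y. \<phi> (f y) \<partial>P)"
    using f_int[OF A] f_eq[OF A] \<phi>int fi by simp
  finally show ?thesis using \<phi>lam by (simp add: algebra_simps)
qed

text \<open>If \<open>Q A\<close> exceeded \<open>\<epsilon>\<close>, the integrated Fenchel--Young
  bound, valid for all multipliers with finite conjugates, would push the adjusted tolerance
  strictly below \<open>\<delta>\<close>.\<close>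

lemma event_le_tol_level:
  assumes P: "prob_space P" and gen: "divergence_generator \<phi>" and lam: "0 < lam" and \<delta>: "0 < \<delta>"
    and Q: "Q \<in> phi_ball \<phi> P lam" and A: "A \<in> sets P" "measure P A \<le> \<delta>"
    and \<epsilon>: "\<epsilon> \<in> tol_levels \<pi> \<delta> lam \<phi>"
  shows "measure Q A \<le> \<epsilon>"
proof (rule ccontr)
  define q where "q = measure Q A"
  define a where "a = measure P A"
  assume "\<not> measure Q A \<le> \<epsilon>"
  then have "\<epsilon> < q" by (simp add: q_def)
  have one: "\<phi> 1 = 0" using gen by (simp add: divergence_generator_def)
  have "q \<le> 1" using Q by (auto simp: q_def phi_ball_def intro: prob_space.prob_le_1)
  have \<epsilon>0: "0 \<le> \<epsilon>" and tol: "ereal \<delta> \<le> adjusted_tol \<pi> \<epsilon> lam \<phi>"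
    using \<epsilon> by (auto simp: tol_levels_def)
  have a: "0 \<le> a" "a \<le> \<delta>" using A by (auto simp: a_def)
  \<comment> \<open>Shrinking the event's mass by the factor \<open>u < 1\<close> turns the weak inequality into the strict one
    needed for an infimum that need not be attained.\<close>
  define u where "u = (q + \<epsilon>) / (2 * q)"
  have u: "0 \<le> u" "u < 1" and uq: "\<epsilon> \<le> u * q"
    using \<open>\<epsilon> < q\<close> \<epsilon>0 by (auto simp: u_def field_simps)
  \<comment> \<open>Shrinking is not strict at mass zero; there \<open>\<delta> > 0\<close> provides
    the gap.\<close>
  have "u * a < \<delta>"
  proof (cases "a = 0")
    case False
    then have "u * a < 1 * a" using u a by (intro mult_strict_right_mono) auto
    then show ?thesis using a by simp
  qed (use \<delta> in simp)
  have "adjusted_tol \<pi> \<epsilon> lam \<phi> \<le> ereal (u * a)"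
  proof (rule adjusted_tol_le[of \<phi>, OF one lam])
    show "\<epsilon> \<le> 1" using \<open>\<epsilon> < q\<close> \<open>q \<le> 1\<close> by simp
    show "0 \<le> u * a" using u a by simp
    fix z0 z c d :: real
    assume z: "0 < z" and c: "phi_conj \<phi> (z0 + z) = ereal c" and d: "phi_conj \<phi> z0 = ereal d"
    \<comment> \<open>The bound \<open>z0 \<le> d\<close> is mixed with the integrated one, with
      weights \<open>1 - u\<close> and \<open>u\<close>; this replaces the mass \<open>a\<close> by
      \<open>u * a\<close>.\<close>
    have "z0 \<le> d" using phi_conj_ge_self[of \<phi> z0, OF one] d by simp
    then have "(1 - u) * z0 \<le> (1 - u) * d" using u by (intro mult_left_mono) auto
    moreover have "u * (z0 + z * q - lam) \<le> u * (a * c + (1 - a) * d)"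
      using phi_ball_event_bound[OF P gen _ Q A(1) c d] lam u
      by (intro mult_left_mono) (auto simp: a_def q_def)
    moreover have "\<epsilon> * z \<le> u * q * z" using uq z by (intro mult_right_mono) auto
    moreover have "u * lam \<le> 1 * lam" using u lam by (intro mult_right_mono) auto
    ultimately show "(1 - u * a) * (c - d) \<le> c - z0 - \<epsilon> * z + lam"
      by (simp add: algebra_simps)
  qed
  with tol have "ereal \<delta> \<le> ereal (u * a)" by (rule order_trans)
  then show False using \<open>u * a < \<delta>\<close> by simp
qed

section \<open>Worst-case values as tolerance levels\<close>

lemma worst_case_value_le_one: "worst_case_value P0 (phi_ball \<phi> P lam) \<delta> \<le> 1"
  unfolding worst_case_value_def
  by (rule Sup_least) (auto simp: phi_ball_def prob_space.prob_le_1)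

lemma center_in_phi_ball:
  assumes P: "prob_space P" and one: "\<phi> 1 = 0"
  shows "P \<in> phi_ball \<phi> P lam"
proof -
  have "phi_divergence \<phi> P (density P (\<lambda>y. ennreal 1)) = 0"
    using one by (subst phi_divergence_density[OF P]) auto
  then show ?thesis
    using P by (simp add: phi_ball_def density_1 absolutely_continuous_def)
qed

text \<open>All two-point tilts on one event of \<open>P\<close>-mass \<open>\<delta>\<close>
  compete in the supremum \<open>m\<close>. So every \<open>q\<close> in \<open>(m, 1]\<close> has
  binary divergence above \<open>lam\<close>, and continuity gives at least \<open>lam\<close> at
  \<open>m\<close> itself.\<close>

lemma worst_case_value_in_tol_levels:
  fixes p :: "real ^ 'k \<Rightarrow> real"
  assumes gen: "divergence_generator \<phi>" and lam: "0 < lam" and \<delta>: "0 < \<delta>"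
    and p: "p \<in> borel_measurable borel" and P: "P = density lborel (\<lambda>y. ennreal (p y))" "prob_space P"
    and adm: "admissible_sampling P P0" and \<pi>: "\<pi> \<in> {-\<infinity>, 0, 1}"
    and less: "worst_case_value P0 (phi_ball \<phi> P lam) \<delta> < 1"
  shows "worst_case_value P0 (phi_ball \<phi> P lam) \<delta> \<in> ereal ` tol_levels \<pi> \<delta> lam \<phi>"
proof -
  interpret P: prob_space P by fact
  have P0: "prob_space P0" and s0: "sets P0 = sets borel"
    using adm by (auto simp: admissible_sampling_def)
  have sets: "sets P = sets borel" by (simp add: P)
  have one: "\<phi> 1 = 0" and nn: "\<forall>x\<ge>0. 0 \<le> \<phi> x"
    using gen by (auto simp: divergence_generator_def)
  let ?W = "worst_case_value P0 (phi_ball \<phi> P lam) \<delta>"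
  \<comment> \<open>For \<open>\<delta> \<ge> 1\<close> the whole space is an allowed event, and the
    center of the ball already gives the value \<open>1\<close>.\<close>
  have "\<delta> < 1"
  proof (rule ccontr)
    assume "\<not> \<delta> < 1"
    then have "measure P0 UNIV \<le> \<delta>"
      using prob_space.prob_le_1[OF P0, of UNIV] by simp
    then have "ereal (measure P UNIV) \<le> ?W"
      unfolding worst_case_value_def using center_in_phi_ball[of P \<phi>, OF P(2) one] s0
      by (intro Sup_upper CollectI exI[of _ P] exI[of _ UNIV]) auto
    then show False using less P.prob_space sets_eq_imp_space_eq[OF sets] by (simp add: one_ereal_def)
  qed
  obtain A where A: "A \<in> sets borel" "measure P A = \<delta>" "measure P0 A \<le> \<delta>"
    using admissible_sampling_event[OF p P adm] \<delta> \<open>\<delta> < 1\<close> by (metis less_imp_le)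
  have W: "ereal q \<le> ?W" if q: "0 \<le> q" "q \<le> 1" "binary_divergence \<phi> \<delta> q \<le> lam" for q
  proof -
    obtain Q where "Q \<in> phi_ball \<phi> P lam" "measure Q A = q"
      using two_point_tilting[OF P(2) _ A(2) \<delta> \<open>\<delta> < 1\<close> q(1,2) nn q(3)] A(1) sets by metis
    then show ?thesis
      unfolding worst_case_value_def using A s0 by (intro Sup_upper) auto
  qed
  have D\<delta>: "binary_divergence \<phi> \<delta> \<delta> = 0"
    using \<delta> \<open>\<delta> < 1\<close> one by (simp add: binary_divergence_def)
  have "ereal \<delta> \<le> ?W" using W[of \<delta>] D\<delta> \<delta> \<open>\<delta> < 1\<close> lam by simp
  then obtain m where m: "?W = ereal m" using less by (cases ?W) auto
  have m': "\<delta> \<le> m" "m < 1" using \<open>ereal \<delta> \<le> ?W\<close> less by (auto simp: m)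
  obtain \<phi>' where d1: "\<And>x. 0 < x \<Longrightarrow> (\<phi> has_real_derivative \<phi>' x) (at x)"
    using gen by (rule generator_derivative) blast
  \<comment> \<open>Differentiability gives continuity at positive points;
    \<open>0 < \<delta> \<le> m < 1\<close> keeps both ratios positive.\<close>
  have "isCont \<phi> x" if "0 < x" for x using d1[OF that] by (rule DERIV_isCont)
  then have "isCont \<phi> (m / \<delta>)" "isCont \<phi> ((1 - m) / (1 - \<delta>))"
    using \<delta> \<open>\<delta> < 1\<close> m' by auto
  moreover have "isCont (\<lambda>q. q / \<delta>) m" "isCont (\<lambda>q. (1 - q) / (1 - \<delta>)) m"
    using \<delta> \<open>\<delta> < 1\<close> by (auto intro!: continuous_intros)
  ultimately have "isCont (\<lambda>q. \<phi> (q / \<delta>)) m" "isCont (\<lambda>q. \<phi> ((1 - q) / (1 - \<delta>))) m"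
    by (auto intro: isCont_o2)
  then have "isCont (binary_divergence \<phi> \<delta>) m"
    unfolding binary_divergence_def[abs_def] by (intro isCont_add isCont_mult continuous_const)
  then have "(binary_divergence \<phi> \<delta> \<longlongrightarrow> binary_divergence \<phi> \<delta> m) (at_right m)"
    by (auto simp: isCont_def intro: tendsto_within_subset)
  moreover have "\<forall>\<^sub>F q in at_right m. lam \<le> binary_divergence \<phi> \<delta> q"
    using eventually_at_right_less[of m] eventually_at_right_real[OF m'(2)]
  proof eventually_elim
    case (elim q)
    show ?case
    proof (rule ccontr)
      assume "\<not> lam \<le> binary_divergence \<phi> \<delta> q"
      then have "ereal q \<le> ?W" using elim m' \<delta> by (intro W) auto
      then show False using elim m by simp
    qed
  qed
  ultimately have D: "lam \<le> binary_divergence \<phi> \<delta> m"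
    by (rule tendsto_lowerbound) simp
  \<comment> \<open>The divergence is \<open>0\<close> at \<open>\<delta>\<close> but at least
    \<open>lam > 0\<close> at \<open>m\<close>, so the certificate has distinct ratios.\<close>
  then have "m \<noteq> \<delta>" using D\<delta> lam by auto
  then have "m \<in> tol_levels \<pi> \<delta> lam \<phi>"
    using m' by (intro binary_divergence_in_tol_levels[OF gen \<pi> \<delta> _ _ D]) auto
  with m show ?thesis by simp
qed

theorem theorem3p2p1:
  fixes P :: "(real ^ 'k) measure"
    and p :: "real ^ 'k \<Rightarrow> real"
    and \<phi> :: "real \<Rightarrow> real"
    and lam \<delta> :: real
  assumes "divergence_generator \<phi>"
    and "lam > 0" and "\<delta> > 0"
    and "p \<in> borel_measurable borel" and "\<forall>y. 0 \<le> p y"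
    and "P = density lborel (\<lambda>y. ennreal (p y))" and "prob_space P"
  shows "is_arg_min (\<lambda>P0. worst_case_value P0 (phi_ball \<phi> P lam) \<delta>) (admissible_sampling P) P \<and>
    (\<forall>A\<in>sets borel.
       worst_case_value P (phi_ball \<phi> P lam) \<delta> = adjusted_tol_inv (tol_pi p A) \<delta> lam \<phi> \<and>
       (tol_levels (tol_pi p A) \<delta> lam \<phi> \<inter> {..1} \<noteq> {} \<longrightarrow>
         adjusted_tol_inv (tol_pi p A) \<delta> lam \<phi> \<in> ereal ` tol_levels (tol_pi p A) \<delta> lam \<phi>))"
proof -
  let ?W = "\<lambda>P0. worst_case_value P0 (phi_ball \<phi> P lam) \<delta>"
  note attain = worst_case_value_in_tol_levels[OF assms(1-4,6,7)]
  have adm: "admissible_sampling P P"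
    using assms(6,7)
    by (auto simp: admissible_sampling_def density_1 intro!: bexI[of _ "\<lambda>_. 1"])
  have W_le: "?W P \<le> ereal \<epsilon>" if "\<epsilon> \<in> tol_levels \<pi> \<delta> lam \<phi>" for \<pi> \<epsilon>
    unfolding worst_case_value_def
    using event_le_tol_level[OF assms(7,1,2,3) _ _ _ that] by (intro Sup_least) auto
  have "?W P \<le> ?W P0" if P0: "admissible_sampling P P0" for P0
  proof (cases "?W P0 < 1")
    case True
    \<comment> \<open>Optimality does not mention \<open>\<pi>\<close>, so the value
      \<open>0\<close> is fixed; the same \<open>m\<close> then bounds the value at \<open>P\<close>
      by weak duality.\<close>
    then obtain m where "m \<in> tol_levels 0 \<delta> lam \<phi>" "?W P0 = ereal m"
      using attain[OF P0, of 0] by auto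
    then show ?thesis using W_le by metis
  next
    case False
    then show ?thesis
      using worst_case_value_le_one[of P \<phi> P lam \<delta>] by (meson linorder_not_less order_trans)
  qed
  then have min: "is_arg_min ?W (admissible_sampling P) P"
    using adm by (auto simp: is_arg_min_def not_less)
  have "?W P = adjusted_tol_inv \<pi> \<delta> lam \<phi> \<and>
      (tol_levels \<pi> \<delta> lam \<phi> \<inter> {..1} \<noteq> {} \<longrightarrow>
        adjusted_tol_inv \<pi> \<delta> lam \<phi> \<in> ereal ` tol_levels \<pi> \<delta> lam \<phi>)"
    if \<pi>: "\<pi> \<in> {-\<infinity>, 0, 1}" for \<pi>
  proof -
    have lower: "?W P \<le> adjusted_tol_inv \<pi> \<delta> lam \<phi>"
      unfolding adjusted_tol_inv_def using W_le by (intro INF_greatest) auto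
    have upper: "adjusted_tol_inv \<pi> \<delta> lam \<phi> \<le> ereal \<epsilon>" if "\<epsilon> \<in> tol_levels \<pi> \<delta> lam \<phi>" for \<epsilon>
      unfolding adjusted_tol_inv_def using that by (rule INF_lower)
    show ?thesis
    proof (cases "?W P < 1")
      case True
      then obtain m where m: "m \<in> tol_levels \<pi> \<delta> lam \<phi>" "?W P = ereal m"
        using attain[OF adm \<pi>] by auto
      then have "adjusted_tol_inv \<pi> \<delta> lam \<phi> = ereal m"
        using lower upper[OF m(1)] by simp
      then show ?thesis using m by simp
    next
      case False
      then have W: "?W P = 1"
        using worst_case_value_le_one[of P \<phi> P lam \<delta>] by (meson linorder_not_less order_antisym)
      \<comment> \<open>Every \<open>1 + e\<close> with \<open>e > 0\<close> is a level, so the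
        infimum is at most \<open>1\<close> even if \<open>1\<close> is not a level.\<close>
      have "adjusted_tol_inv \<pi> \<delta> lam \<phi> \<le> 1"
      proof (rule ereal_le_epsilon2)
        fix e :: real assume "0 < e"
        then show "adjusted_tol_inv \<pi> \<delta> lam \<phi> \<le> 1 + ereal e"
          using upper[OF gt_one_in_tol_levels[OF assms(1) \<pi>, of "1 + e"]] by (simp add: one_ereal_def)
      qed
      then have eq: "adjusted_tol_inv \<pi> \<delta> lam \<phi> = 1" using lower W by simp
      \<comment> \<open>Weak duality forbids levels below the value \<open>1\<close>, so a level in
        \<open>{..1}\<close> is \<open>1\<close> itself and the minimum is attained.\<close>
      have "1 \<in> tol_levels \<pi> \<delta> lam \<phi>" if \<epsilon>: "\<epsilon> \<in> tol_levels \<pi> \<delta> lam \<phi>" "\<epsilon> \<le> 1" for \<epsilon>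
      proof -
        have "\<epsilon> = 1" using W_le[OF \<epsilon>(1)] \<epsilon>(2) W by (simp add: one_ereal_def)
        then show ?thesis using \<epsilon>(1) by simp
      qed
      then show ?thesis using eq W by (force simp: one_ereal_def)
    qed
  qed
  moreover have "tol_pi p A \<in> {-\<infinity>, 0, 1}" for A
    by (simp add: tol_pi_def)
  ultimately show ?thesis using min by blast
qed

end
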